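(* Let $s\ge 1$ be an integer and let $(A_n)_{n\ge 0}$ be the sequence defined by $A_0=0$, $A_1=1$ and $A_{n+2}=sA_{n+1}+A_n$ for $n\ge 0$. Then for all integers $m\ge 1$ and $n\ge 0$, $$A_{(2m+1)n} = \sum_{i=0}^m (-1)^{n(m+i)}\, (s^2 + 4)^{i}\, \frac{2m+1}{2i+1} \binom{m+i}{2i} A_{n}^{2i+1}.$$
   Context: The identity is between rational numbers. *)

theory Defs
  imports Complex_Main
begin

end

theory Submission
  imports Defs
begin

text \<open>
  Fix \<open>n\<close> and put \<open>\<epsilon> = (-1)^n\<close>, \<open>y = (s\<^sup>2 + 4) (A n)\<^sup>2\<close>. Both sides of the identity, as functions of
  \<open>m\<close>, satisfy the same recurrence \<open>u (m + 2) = (y + 2 \<epsilon>) u (m + 1) - u m\<close>, and they agree for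
  \<open>m = 0\<close> and \<open>m = 1\<close>.

  For the left side this is the fact that the values of \<open>A\<close> along an arithmetic progression of
  difference \<open>p\<close> obey a second-order recurrence whose trace is the companion number
  \<open>L p = 2 A (p + 1) - s A p\<close> (in terms of the roots \<open>\<alpha>, \<beta>\<close> of \<open>x\<^sup>2 = s x + 1\<close>, \<open>L p = \<alpha>^p + \<beta>^p\<close>)
  and whose determinant is \<open>(\<alpha> \<beta>)^p = (-1)^p\<close>. Here \<open>p = 2 n\<close>, and \<open>L (2 n) = y + 2 \<epsilon>\<close>
  (lemmas \<open>step_recurrence\<close> and \<open>companion_double\<close>). The roots themselves are avoided: everything
  follows from the addition law and the Cassini identity, which hold in every commutative ring.

  For the right side, the coefficient \<open>(2 m + 1) / (2 i + 1) * binom (m + i) (2 i)\<close> equals the integer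
  \<open>2 binom (m + i + 1) (2 i + 1) - binom (m + i) (2 i)\<close>. In this form Pascal's rule, applied twice,
  computes its second difference in \<open>m\<close> as the coefficient at \<open>(m + 1, i - 1)\<close>, which is the
  recurrence above read off coefficient by coefficient (lemmas \<open>coeff_second_difference\<close> and
  \<open>odd_multiple_poly_recurrence\<close>).
\<close>

locale lucas_sequence =
  fixes s :: "'a::comm_ring_1" and A :: "nat \<Rightarrow> 'a"
  assumes A_0 [simp]: "A 0 = 0"
    and A_1 [simp]: "A (Suc 0) = 1"
    and A_rec: "A (Suc (Suc k)) = s * A (Suc k) + A k"
begin

lemma addition: "A (k + p) = A (Suc k) * A p + A k * (A (Suc p) - s * A p)"
  and addition_Suc: "A (Suc (k + p)) = A (Suc k) * A (Suc p) + A k * A p"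
proof (induction k)
  case 0
  { case 1 show ?case by simp }
  { case 2 show ?case by simp }
next
  case (Suc k)
  { case 1 show ?case using Suc by (simp add: A_rec algebra_simps) }
  { case 2 show ?case using Suc by (simp add: A_rec algebra_simps) }
qed

lemma Cassini: "A (Suc p) ^ 2 - s * A p * A (Suc p) - A p ^ 2 = (-1) ^ p"
proof (induction p)
  case (Suc p)
  have "A (Suc (Suc p)) ^ 2 - s * A (Suc p) * A (Suc (Suc p)) - A (Suc p) ^ 2
      = - (A (Suc p) ^ 2 - s * A p * A (Suc p) - A p ^ 2)"
    by (simp add: A_rec power2_eq_square algebra_simps)
  then show ?case using Suc by simp
qed simp

definition companion :: "nat \<Rightarrow> 'a" where
  "companion p = 2 * A (Suc p) - s * A p"

lemma double: "A (p + p) = companion p * A p"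
  by (simp add: addition companion_def algebra_simps)

lemma companion_double: "companion (p + p) = (s ^ 2 + 4) * A p ^ 2 + 2 * (-1) ^ p"
  unfolding companion_def addition_Suc double Cassini [of p, symmetric]
  by (simp add: power2_eq_square algebra_simps)

text \<open>
  By the addition law both sides are linear in \<open>A (k + 1)\<close> and \<open>A k\<close>. The coefficients of \<open>A (k + 1)\<close>
  agree by doubling, and those of \<open>A k\<close> agree because of the Cassini identity; this is the
  Cayley-Hamilton theorem for the \<open>p\<close>-th power of the companion matrix of the recurrence.
\<close>

lemma step_recurrence: "A (k + (p + p)) = companion p * A (k + p) - (-1) ^ p * A k"
  unfolding addition [of k] double addition_Suc [of p p] Cassini [of p, symmetric]
  by (simp add: companion_def power2_eq_square algebra_simps)

lemma odd_multiple_recurrence: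
  "A ((2 * Suc (Suc m) + 1) * n)
    = ((s ^ 2 + 4) * A n ^ 2 + 2 * (-1) ^ n) * A ((2 * Suc m + 1) * n) - A ((2 * m + 1) * n)"
proof -
  have "(2 * Suc (Suc m) + 1) * n = (2 * m + 1) * n + ((n + n) + (n + n))"
    and "(2 * Suc m + 1) * n = (2 * m + 1) * n + (n + n)"
    by (simp_all add: algebra_simps)
  moreover have "(-1) ^ (n + n) = (1 :: 'a)"
    by (simp add: power_add flip: power_mult_distrib)
  ultimately show ?thesis
    by (simp only: step_recurrence companion_double mult_1)
qed

lemma triple: "A (3 * n) = ((s ^ 2 + 4) * A n ^ 2 + 3 * (-1) ^ n) * A n"
proof -
  have square: "companion n ^ 2 = (s ^ 2 + 4) * A n ^ 2 + 4 * (-1) ^ n"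
    unfolding companion_def Cassini [of n, symmetric]
    by (simp add: power2_eq_square algebra_simps)
  have "A (3 * n) = companion n ^ 2 * A n - (-1) ^ n * A n"
    using step_recurrence [of n n]
    by (simp add: double power2_eq_square mult.assoc numeral_3_eq_3)
  then show ?thesis
    by (simp add: square algebra_simps)
qed

end

definition odd_multiple_coeff :: "nat \<Rightarrow> nat \<Rightarrow> int" where
  "odd_multiple_coeff m i = 2 * int (Suc (m + i) choose Suc (2 * i)) - int ((m + i) choose (2 * i))"

text \<open>
  Absorption, \<open>(2 i + 1) binom (m + i + 1) (2 i + 1) = (m + i + 1) binom (m + i) (2 i)\<close>, together with
  \<open>2 (m + i + 1) - (2 i + 1) = 2 m + 1\<close>.
\<close>

lemma odd_multiple_coeff_eq_quotient:
  "of_int (odd_multiple_coeff m i)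
    = (of_nat (2 * m + 1) / of_nat (2 * i + 1) * of_nat ((m + i) choose (2 * i)) :: 'a::field_char_0)"
proof -
  have "of_nat (Suc (2 * i)) * of_nat (Suc (m + i) choose Suc (2 * i))
      = (of_nat (Suc (m + i)) * of_nat ((m + i) choose (2 * i)) :: 'a)"
    by (metis Suc_times_binomial_eq mult.commute of_nat_mult)
  then have "of_nat (2 * i + 1) * of_int (odd_multiple_coeff m i)
      = (of_nat (2 * m + 1) * of_nat ((m + i) choose (2 * i)) :: 'a)"
    by (simp add: odd_multiple_coeff_def right_diff_distrib mult.left_commute [of _ 2]
        del: binomial_Suc_Suc) (simp add: algebra_simps)
  moreover have "of_nat (2 * i + 1) \<noteq> (0 :: 'a)"
    by (metis add_is_0 of_nat_eq_0_iff one_neq_zero)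
  ultimately show ?thesis
    by (simp add: field_simps)
qed

lemma coeff_eq_0: "m < i \<Longrightarrow> odd_multiple_coeff m i = 0"
  by (simp add: odd_multiple_coeff_def binomial_eq_0)

lemma coeff_0 [simp]: "odd_multiple_coeff m 0 = 2 * int m + 1"
  by (simp add: odd_multiple_coeff_def)

lemma coeff_second_difference:
  "odd_multiple_coeff (Suc (Suc m)) (Suc i)
    = odd_multiple_coeff (Suc m) i + 2 * odd_multiple_coeff (Suc m) (Suc i)
      - odd_multiple_coeff m (Suc i)"
  by (simp add: odd_multiple_coeff_def)

definition odd_multiple_poly :: "'a::comm_ring_1 \<Rightarrow> 'a \<Rightarrow> nat \<Rightarrow> 'a" where
  "odd_multiple_poly e y m = (\<Sum>i\<le>m. e ^ (m + i) * of_int (odd_multiple_coeff m i) * y ^ i)"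

lemma odd_multiple_poly_extend:
  assumes "m \<le> N"
  shows "odd_multiple_poly e y m = (\<Sum>i\<le>N. e ^ (m + i) * of_int (odd_multiple_coeff m i) * y ^ i)"
  unfolding odd_multiple_poly_def
  by (rule sum.mono_neutral_left) (use assms in \<open>auto simp: coeff_eq_0\<close>)

lemma odd_multiple_poly_recurrence:
  assumes e: "e * e = 1"
  shows "odd_multiple_poly e y (Suc (Suc m))
    = (y + 2 * e) * odd_multiple_poly e y (Suc m) - odd_multiple_poly e y m"
proof -
  let ?t = "\<lambda>m i. e ^ (m + i) * of_int (odd_multiple_coeff m i) * y ^ i"
  have e': "e * (e * z) = z" for z
    by (metis e mult.assoc mult_1)
  have zero: "?t (Suc (Suc m)) 0 = 2 * e * ?t (Suc m) 0 - ?t m 0"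
    by (simp add: e' algebra_simps)
  have Suc: "?t (Suc (Suc m)) (Suc i) = y * ?t (Suc m) i + 2 * e * ?t (Suc m) (Suc i) - ?t m (Suc i)" for i
    by (simp add: coeff_second_difference e' algebra_simps)
  \<comment> \<open>Padded with zero coefficients, the polynomials at \<open>m\<close> and \<open>m + 1\<close> also run up to
    degree \<open>m + 2\<close>, so that the three can be compared index by index.\<close>
  have "odd_multiple_poly e y (Suc (Suc m))
      = ?t (Suc (Suc m)) 0 + (\<Sum>i\<le>Suc m. ?t (Suc (Suc m)) (Suc i))"
    unfolding odd_multiple_poly_def by (rule sum.atMost_Suc_shift)
  also have "\<dots> = y * (\<Sum>i\<le>Suc m. ?t (Suc m) i)
      + 2 * e * (?t (Suc m) 0 + (\<Sum>i\<le>Suc m. ?t (Suc m) (Suc i)))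
      - (?t m 0 + (\<Sum>i\<le>Suc m. ?t m (Suc i)))"
    by (simp only: zero Suc sum.distrib sum_subtractf sum_distrib_left [symmetric])
      (simp only: algebra_simps)
  also have "\<dots> = y * odd_multiple_poly e y (Suc m)
      + 2 * e * odd_multiple_poly e y (Suc m) - odd_multiple_poly e y m"
  proof -
    have "odd_multiple_poly e y k = ?t k 0 + (\<Sum>i\<le>Suc m. ?t k (Suc i))" if "k \<le> Suc (Suc m)" for k
      unfolding odd_multiple_poly_extend [OF that] by (rule sum.atMost_Suc_shift)
    from this [of "Suc m"] this [of m] show ?thesis
      unfolding odd_multiple_poly_def [of e y "Suc m", symmetric] by simp
  qed
  finally show ?thesis
    by (simp add: distrib_right)
qed

lemma (in lucas_sequence) odd_multiple_eq_poly:
  "A ((2 * m + 1) * n) = odd_multiple_poly ((-1) ^ n) ((s ^ 2 + 4) * A n ^ 2) m * A n"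
proof (induction m rule: induct_nat_012)
  case 0
  show ?case by (simp add: odd_multiple_poly_def)
next
  case 1
  have "odd_multiple_coeff (Suc 0) (Suc 0) = 1"
    by (simp add: odd_multiple_coeff_def numeral_eq_Suc)
  then have "odd_multiple_poly ((-1) ^ n) y (Suc 0) = y + 3 * (-1) ^ n" for y :: 'a
    by (simp add: odd_multiple_poly_def algebra_simps flip: power_add)
  moreover have "(2 * Suc 0 + 1) * n = 3 * n"
    by simp
  ultimately show ?case
    by (simp only: triple)
next
  case (ge2 m)
  have e: "(-1) ^ n * (-1) ^ n = (1 :: 'a)"
    by (simp flip: power_add)
  show ?case
    unfolding odd_multiple_recurrence ge2 odd_multiple_poly_recurrence [OF e]
    by (simp only: left_diff_distrib mult.assoc)
qed

theorem corollary1: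
  fixes s :: int and A :: "nat \<Rightarrow> int" and m n :: nat
  assumes "s \<ge> 1"
    and "A 0 = 0"
    and "A 1 = 1"
    and "\<And>k. A (k + 2) = s * A (k + 1) + A k"
    and "m \<ge> 1"
  shows "rat_of_int (A ((2 * m + 1) * n)) =
    (\<Sum>i = 0..m. (- 1) ^ (n * (m + i)) * (rat_of_int s ^ 2 + 4) ^ i
       * (rat_of_nat (2 * m + 1) / rat_of_nat (2 * i + 1))
       * rat_of_nat ((m + i) choose (2 * i))
       * rat_of_int (A n) ^ (2 * i + 1))"
proof -
  interpret lucas_sequence s A
    by unfold_locales (use assms in \<open>auto simp: numeral_2_eq_2\<close>)
  have "rat_of_int (A ((2 * m + 1) * n))
      = (\<Sum>i\<le>m. (- 1) ^ (n * (m + i)) * rat_of_int (odd_multiple_coeff m i)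
          * ((rat_of_int s ^ 2 + 4) * rat_of_int (A n) ^ 2) ^ i * rat_of_int (A n))"
    unfolding odd_multiple_eq_poly odd_multiple_poly_def
    by (simp add: sum_distrib_right power_mult)
  also have "\<dots> = (\<Sum>i = 0..m. (- 1) ^ (n * (m + i)) * (rat_of_int s ^ 2 + 4) ^ i
       * (rat_of_nat (2 * m + 1) / rat_of_nat (2 * i + 1))
       * rat_of_nat ((m + i) choose (2 * i))
       * rat_of_int (A n) ^ (2 * i + 1))"
    unfolding odd_multiple_coeff_eq_quotient atLeast0AtMost
    by (intro sum.cong refl) (simp only: power_mult_distrib power_mult power_add power_one_right, simp only: mult_ac)
  finally show ?thesis .
qed

end
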